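(* Let $(L,\cdot,\alpha)$ be a (left) Hom-Leibniz algebra over a field $\mathbb{K}$ of characteristic $0$ and let $a\in L$. For $n\ge 1$ let $a^n$ denote the $n$th left Hom-power of $a$, defined by $a^1=a$ and $a^n=\alpha^{n-2}(a)\cdot a^{n-1}$ for $n\ge 2$. Then $L_{a^n}\circ\alpha = 0$ for all $n\ge 2$, where for $z\in L$ the map $L_z: L\to L$ is left multiplication, $L_z x = z\cdot x$.
   Context: A Hom-algebra is a triple $(A,\cdot,\alpha)$ where $A$ is a $\mathbb{K}$-vector space, $\cdot$ is a bilinear binary operation on $A$, and $\alpha: A\to A$ is a linear map that is multiplicative: $\alpha(x\cdot y)=\alpha(x)\cdot\alpha(y)$ for all $x,y\in A$. A (left) Hom-Leibniz algebra is a Hom-algebra $(A,\cdot,\alpha)$ such that $\alpha(x)\cdot(y\cdot z) = (x\cdot y)\cdot\alpha(z) + \alpha(y)\cdot(x\cdot z)$ for all $x,y,z\in A$. Here $\alpha^m$ is the $m$-fold composition of $\alpha$, with $\alpha^0=\mathrm{Id}$. *)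

theory Defs
  imports Complex_Main
begin

text \<open>The vector space \<open>A\<close> is the whole type \<open>'a\<close>, with scalar multiplication \<open>scale\<close> over the
  field \<open>'k\<close>. Multiplicativity of the twisting map is part of the notion of Hom-algebra.\<close>

locale hom_algebra = vector_space scale
  for scale :: "'k::field \<Rightarrow> 'a::ab_group_add \<Rightarrow> 'a" +
  fixes mult :: "'a \<Rightarrow> 'a \<Rightarrow> 'a"
    and \<alpha> :: "'a \<Rightarrow> 'a"
  assumes linear_mult_left: "Vector_Spaces.linear scale scale (\<lambda>x. mult x y)"
    and linear_mult_right: "Vector_Spaces.linear scale scale (\<lambda>y. mult x y)"
    and linear_twist: "Vector_Spaces.linear scale scale \<alpha>"
    and multiplicative: "\<alpha> (mult x y) = mult (\<alpha> x) (\<alpha> y)"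

locale left_hom_leibniz_algebra = hom_algebra +
  assumes left_hom_leibniz:
    "mult (\<alpha> x) (mult y z) = mult (mult x y) (\<alpha> z) + mult (\<alpha> y) (mult x z)"

text \<open>The left Hom-power \<open>a\<^sup>n\<close> is meaningful only for \<open>n \<ge> 1\<close>; the value at \<open>0\<close> is left
  unspecified. The last equation is the recursion for \<open>a\<^sup>n\<close> at index \<open>n + 2\<close>.\<close>

fun left_hom_power :: "('a \<Rightarrow> 'a \<Rightarrow> 'a) \<Rightarrow> ('a \<Rightarrow> 'a) \<Rightarrow> 'a \<Rightarrow> nat \<Rightarrow> 'a" where
  "left_hom_power mult \<alpha> a 0 = undefined"
| "left_hom_power mult \<alpha> a (Suc 0) = a"
| "left_hom_power mult \<alpha> a (Suc (Suc n)) =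
     mult ((\<alpha> ^^ n) a) (left_hom_power mult \<alpha> a (Suc n))"

definition left_mult :: "('a \<Rightarrow> 'a \<Rightarrow> 'a) \<Rightarrow> 'a \<Rightarrow> 'a \<Rightarrow> 'a" where
  "left_mult mult z = (\<lambda>x. mult z x)"

end

theory Submission
  imports Defs
begin

text \<open>Exchanging \<open>x\<close> and \<open>y\<close> in the Hom-Leibniz identity and adding gives
  \<open>(x \<cdot> y) \<cdot> \<alpha>(z) = - (y \<cdot> x) \<cdot> \<alpha>(z)\<close>. For \<open>x = \<alpha>\<^sup>n\<^sup>-\<^sup>1(a)\<close> and \<open>y = a\<^sup>n\<close> with \<open>n \<ge> 2\<close>, the
  product \<open>y \<cdot> x = a\<^sup>n \<cdot> \<alpha>(\<alpha>\<^sup>n\<^sup>-\<^sup>2(a))\<close> vanishes by induction, hence so does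
  \<open>a\<^sup>n\<^sup>+\<^sup>1 \<cdot> \<alpha>(z) = (x \<cdot> y) \<cdot> \<alpha>(z)\<close>.\<close>

context left_hom_leibniz_algebra
begin

lemma mult_zero_left: "mult 0 x = 0"
proof -
  interpret Vector_Spaces.linear scale scale "\<lambda>y. mult y x"
    by (rule linear_mult_left)
  show ?thesis by (rule zero)
qed

lemma mult_mult_twist_skew: "mult (mult x y) (\<alpha> z) = - mult (mult y x) (\<alpha> z)"
proof -
  \<comment> \<open>The identity is applied twice, the second time with \<open>x\<close> and
    \<open>y\<close> exchanged to expand the last summand; the left side then reappears on the right
    and cancels.\<close>
  have "mult (\<alpha> x) (mult y z) =
      mult (mult x y) (\<alpha> z) + (mult (mult y x) (\<alpha> z) + mult (\<alpha> x) (mult y z))"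
    by (metis left_hom_leibniz)
  then show ?thesis
    by (simp add: eq_neg_iff_add_eq_0 flip: add.assoc)
qed

text \<open>For \<open>y = x\<close> the last summand of the identity equals its left side. This is
  the base case, the square of \<open>a\<close>.\<close>

lemma mult_self_twist: "mult (mult x x) (\<alpha> z) = 0"
  using left_hom_leibniz[of x x z] by simp

lemma mult_left_hom_power_twist:
  "mult (left_hom_power mult \<alpha> a (Suc (Suc n))) (\<alpha> z) = 0"
proof (induction n arbitrary: z)
  case 0
  show ?case by (simp add: mult_self_twist)
next
  case (Suc n)
  let ?p = "left_hom_power mult \<alpha> a (Suc (Suc n))"
  \<comment> \<open>The hypothesis is taken at \<open>z = (\<alpha> ^^ n) a\<close>, whose image
    under \<open>\<alpha>\<close> is the left factor of the next power; hence \<open>z\<close> is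
    kept arbitrary.\<close>
  have "mult ?p ((\<alpha> ^^ Suc n) a) = 0"
    using Suc.IH[of "(\<alpha> ^^ n) a"] by simp
  then have "mult (mult ((\<alpha> ^^ Suc n) a) ?p) (\<alpha> z) = 0"
    by (subst mult_mult_twist_skew) (simp only: mult_zero_left minus_zero)
  then show ?case
    by (simp only: left_hom_power.simps(3))
qed

end

theorem theorem3p10:
  fixes scale :: "'k::field_char_0 \<Rightarrow> 'l::ab_group_add \<Rightarrow> 'l"
    and mult :: "'l \<Rightarrow> 'l \<Rightarrow> 'l"
    and \<alpha> :: "'l \<Rightarrow> 'l"
    and a :: 'l
    and n :: nat
  assumes "left_hom_leibniz_algebra scale mult \<alpha>"
    and "n \<ge> 2"
  shows "left_mult mult (left_hom_power mult \<alpha> a n) \<circ> \<alpha> = (\<lambda>_. 0)"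
proof -
  interpret left_hom_leibniz_algebra scale mult \<alpha> by (rule assms(1))
  obtain m where "n = Suc (Suc m)"
    using \<open>n \<ge> 2\<close> by (metis add_2_eq_Suc le_Suc_ex)
  then show ?thesis
    by (simp only: left_mult_def comp_def mult_left_hom_power_twist)
qed

end
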